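(* Let $p$ be a prime number and let $\mathcal H$ be a $p$-uniform hypergraph with at least one edge. Then $$\chi_l(\mathcal H)\geq\min\left(\left\lceil\frac{\mathrm{Xind}_{\mathbb Z_p}(\mathrm{Hom}(K^p_p,\mathcal H))+p}{p}\right\rceil+1,\ \left\lceil\frac{\mathrm{Xind}_{\mathbb Z_p}(\mathrm{Hom}(K^p_p,\mathcal H))+p}{p-1}\right\rceil\right).$$
   Context: A hypergraph $\mathcal H$ has a finite vertex set $V(\mathcal H)$ and an edge set $E(\mathcal H)$ which is a family of nonempty subsets of $V(\mathcal H)$; it is $p$-uniform if all edges have size $p$. A proper coloring is a map on $V(\mathcal H)$ with no monochromatic edge. Local chromatic number. For $X\subseteq V(\mathcal H)$, let $\mathcal N(X)=\{v\in V(\mathcal H):\exists e\in E(\mathcal H)\text{ with } e\setminus X=\{v\}\}$ and let the closed neighborhood be $\mathcal N[X]=X\cup\mathcal N(X)$. For a uniform hypergraph, $\chi_l(\mathcal H)=\min_c\max\{|c(\mathcal N[e\setminus\{v\}])|: e\in E(\mathcal H),\ v\in e\}$, the minimum over all proper colorings $c$ of $\mathcal H$ (with any number of colors). For pairwise disjoint $U_1,\dots,U_p\subseteq V(\mathcal H)$, $\mathcal H[U_1,\dots,U_p]$ is the hypergraph with vertex set $\bigcup_i U_i$ and edge set $\{e\in E(\mathcal H): e\subseteq\bigcup_iU_i,\ |e\cap U_i|\leq 1\ \forall i\in[p]\}$; it is a complete $p$-uniform $p$-partite hypergraph if it contains every $p$-subset of $\bigcup_iU_i$ meeting each $U_i$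 in at most one vertex. Cross-index. $\mathbb Z_p=\{\omega^1,\dots,\omega^p\}$ is the cyclic group of order $p$ with generator $\omega$. A $\mathbb Z_p$-poset is a poset on which $\mathbb Z_p$ acts by order automorphisms; it is free if non-identity elements have no fixed points. $Q_{n,p}$ is the free $\mathbb Z_p$-poset on $\mathbb Z_p\times[n+1]$ with $(\epsilon,i)<(\epsilon',j)$ iff $i<j$ and action $\epsilon\cdot(\epsilon',j)=(\epsilon\epsilon',j)$. $\mathrm{Xind}_{\mathbb Z_p}(P)$ is the least $n$ such that there is an order-preserving $\mathbb Z_p$-equivariant map $P\to Q_{n,p}$. Hom complex. $\mathrm{Hom}(K^p_p,\mathcal H)$ is the free $\mathbb Z_p$-poset of all ordered $p$-tuples $(U_1,\dots,U_p)$ of nonempty pairwise disjoint subsets of $V(\mathcal H)$ such that $\mathcal H[U_1,\dots,U_p]$ is a complete $p$-uniform $p$-partite hypergraph, ordered by $(U_1,\dots,U_p)\preceq(U'_1,\dots,U'_p)$ iff $U_i\subseteq U'_i$ for all $i$, with action $\omega^i\cdot(U_1,\dots,U_p)=(U_{1+i},\dots,U_{p+i})$, where $U_j=U_{j-p}$ for $j>p$. *)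

theory Defs
  imports Complex_Main "HOL-Computational_Algebra.Primes" "HOL-Algebra.Elementary_Groups" "HOL-Algebra.Group_Action"
begin

section \<open>Hypergraphs and the local chromatic number\<close>

definition hypergraph :: "'a set \<Rightarrow> 'a set set \<Rightarrow> bool" where
  "hypergraph V E \<longleftrightarrow> finite V \<and> (\<forall>e\<in>E. e \<subseteq> V \<and> e \<noteq> {})"

definition uniform_hypergraph :: "nat \<Rightarrow> 'a set \<Rightarrow> 'a set set \<Rightarrow> bool" where
  "uniform_hypergraph p V E \<longleftrightarrow> hypergraph V E \<and> (\<forall>e\<in>E. card e = p)"

text \<open>Colors are natural numbers; as the vertex sets are finite, this permits any number of
  colors. Values of a coloring outside the vertex set are irrelevant.\<close>

definition proper_coloring :: "'a set set \<Rightarrow> ('a \<Rightarrow> nat) \<Rightarrow> bool" where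
  "proper_coloring E c \<longleftrightarrow> (\<forall>e\<in>E. \<not> (\<exists>k. \<forall>v\<in>e. c v = k))"

definition neighborhood :: "'a set \<Rightarrow> 'a set set \<Rightarrow> 'a set \<Rightarrow> 'a set" where
  "neighborhood V E X = {v \<in> V. \<exists>e\<in>E. e - X = {v}}"

definition closed_neighborhood :: "'a set \<Rightarrow> 'a set set \<Rightarrow> 'a set \<Rightarrow> 'a set" where
  "closed_neighborhood V E X = X \<union> neighborhood V E X"

text \<open>The infimum of a nonempty set of natural numbers is its least element. The value is
  meaningful when the hypergraph has an edge and no edge has size one.\<close>

definition local_chromatic_number :: "'a set \<Rightarrow> 'a set set \<Rightarrow> nat" where
  "local_chromatic_number V E =
     (INF c \<in> {c. proper_coloring E c}.
        Max {card (c ` closed_neighborhood V E (e - {v})) | e v. e \<in> E \<and> v \<in> e})"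

section \<open>Posets with an action of the cyclic group and the cross-index\<close>

text \<open>The group is written additively: the integer \<open>k\<close> in \<open>{0..<p}\<close> stands for the power
  \<open>\<omega>\<^sup>k\<close>, and 0 for the identity \<open>\<omega>\<^sup>p\<close>. As \<^locale>\<open>group_action\<close> requires, actions are extensional
  on the carrier of the poset.\<close>

abbreviation Zp :: "nat \<Rightarrow> int monoid" where
  "Zp p \<equiv> integer_mod_group p"

definition Zp_poset ::
  "nat \<Rightarrow> 'b set \<Rightarrow> ('b \<Rightarrow> 'b \<Rightarrow> bool) \<Rightarrow> (int \<Rightarrow> 'b \<Rightarrow> 'b) \<Rightarrow> bool" where
  "Zp_poset p P leq act \<longleftrightarrow>
     reflp_on P leq \<and> antisymp_on P leq \<and> transp_on P leq \<and>
     group_action (Zp p) P act \<and>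
     (\<forall>g\<in>carrier (Zp p). \<forall>x\<in>P. \<forall>y\<in>P. leq x y \<longleftrightarrow> leq (act g x) (act g y))"

definition free_Zp_poset ::
  "nat \<Rightarrow> 'b set \<Rightarrow> ('b \<Rightarrow> 'b \<Rightarrow> bool) \<Rightarrow> (int \<Rightarrow> 'b \<Rightarrow> 'b) \<Rightarrow> bool" where
  "free_Zp_poset p P leq act \<longleftrightarrow>
     Zp_poset p P leq act \<and>
     (\<forall>g\<in>carrier (Zp p). g \<noteq> \<one>\<^bsub>Zp p\<^esub> \<longrightarrow> (\<forall>x\<in>P. act g x \<noteq> x))"

definition Q_carrier :: "nat \<Rightarrow> nat \<Rightarrow> (int \<times> nat) set" where
  "Q_carrier n p = carrier (Zp p) \<times> {1..n + 1}"

definition Q_le :: "int \<times> nat \<Rightarrow> int \<times> nat \<Rightarrow> bool" where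
  "Q_le x y \<longleftrightarrow> x = y \<or> snd x < snd y"

definition Q_act :: "nat \<Rightarrow> nat \<Rightarrow> int \<Rightarrow> int \<times> nat \<Rightarrow> int \<times> nat" where
  "Q_act n p g = (\<lambda>x \<in> Q_carrier n p. (g \<otimes>\<^bsub>Zp p\<^esub> fst x, snd x))"

text \<open>Only nonnegative \<open>n\<close> are considered, so the index is the intended one for nonempty posets.\<close>

definition Xind ::
  "nat \<Rightarrow> 'b set \<Rightarrow> ('b \<Rightarrow> 'b \<Rightarrow> bool) \<Rightarrow> (int \<Rightarrow> 'b \<Rightarrow> 'b) \<Rightarrow> nat" where
  "Xind p P leq act =
     (LEAST n. \<exists>f \<in> P \<rightarrow> Q_carrier n p. monotone_on P leq Q_le f \<and>
        (\<forall>g\<in>carrier (Zp p). \<forall>x\<in>P. f (act g x) = Q_act n p g (f x)))"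

section \<open>The Hom complex\<close>

text \<open>The tuple \<open>(U\<^sub>1, \<dots>, U\<^sub>p)\<close> is a list of length \<open>p\<close>, so that \<open>U\<^sub>i\<close> is entry \<open>i - 1\<close>. Of the
  hypergraph \<open>\<H>[U\<^sub>1, \<dots>, U\<^sub>p]\<close>, whose vertex set is the union of the parts, only the edge set is
  defined.\<close>

definition parts_edges :: "'a set set \<Rightarrow> 'a set list \<Rightarrow> 'a set set" where
  "parts_edges E Us = {e \<in> E. e \<subseteq> \<Union>(set Us) \<and> (\<forall>i<length Us. card (e \<inter> Us ! i) \<le> 1)}"

definition complete_partite :: "nat \<Rightarrow> 'a set list \<Rightarrow> 'a set set \<Rightarrow> bool" where
  "complete_partite p Us F \<longleftrightarrow>
     (\<forall>S. S \<subseteq> \<Union>(set Us) \<and> card S = p \<and> (\<forall>i<length Us. card (S \<inter> Us ! i) \<le> 1) \<longrightarrow> S \<in> F)"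

definition Hom_carrier :: "nat \<Rightarrow> 'a set \<Rightarrow> 'a set set \<Rightarrow> 'a set list set" where
  "Hom_carrier p V E =
     {Us. length Us = p \<and>
          (\<forall>i<p. Us ! i \<subseteq> V \<and> Us ! i \<noteq> {}) \<and>
          (\<forall>i<p. \<forall>j<p. i \<noteq> j \<longrightarrow> Us ! i \<inter> Us ! j = {}) \<and>
          complete_partite p Us (parts_edges E Us)}"

definition Hom_le :: "'a set list \<Rightarrow> 'a set list \<Rightarrow> bool" where
  "Hom_le = list_all2 (\<subseteq>)"

text \<open>\<^term>\<open>rotate k Us\<close> is the cyclic shift \<open>(U\<^bsub>1+k\<^esub>, \<dots>, U\<^bsub>p+k\<^esub>)\<close>.\<close>

definition Hom_act :: "nat \<Rightarrow> 'a set \<Rightarrow> 'a set set \<Rightarrow> int \<Rightarrow> 'a set list \<Rightarrow> 'a set list" where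
  "Hom_act p V E k = (\<lambda>Us \<in> Hom_carrier p V E. rotate (nat k) Us)"

definition Xind_Hom :: "nat \<Rightarrow> 'a set \<Rightarrow> 'a set set \<Rightarrow> nat" where
  "Xind_Hom p V E = Xind p (Hom_carrier p V E) Hom_le (Hom_act p V E)"

section \<open>Well-definedness\<close>

lemma group_action_ZpI:
  assumes p: "p > 0"
    and ext: "\<And>k. act k \<in> extensional P"
    and cl: "\<And>k x. k \<in> carrier (Zp p) \<Longrightarrow> x \<in> P \<Longrightarrow> act k x \<in> P"
    and id: "\<And>x. x \<in> P \<Longrightarrow> act 0 x = x"
    and mult: "\<And>k l x. k \<in> carrier (Zp p) \<Longrightarrow> l \<in> carrier (Zp p) \<Longrightarrow> x \<in> P \<Longrightarrow>
        act ((k + l) mod int p) x = act k (act l x)"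
  shows "group_action (Zp p) P act"
proof -
  have bij: "act k \<in> Bij P" if k: "k \<in> carrier (Zp p)" for k
  proof -
    define l where "l = (- k) mod int p"
    have l: "l \<in> carrier (Zp p)" using p by (simp add: l_def carrier_integer_mod_group)
    have kl: "(k + l) mod int p = 0" "(l + k) mod int p = 0"
      by (simp_all add: l_def mod_add_right_eq mod_add_left_eq)
    have "bij_betw (act k) P P"
      by (rule bij_betw_byWitness[where f' = "act l"])
         (use mult[OF k l] mult[OF l k] kl id cl[OF k] cl[OF l] in auto)
    then show ?thesis using ext by (simp add: Bij_def)
  qed
  have "act (x \<otimes>\<^bsub>Zp p\<^esub> y) = compose P (act x) (act y)"
    if "x \<in> carrier (Zp p)" "y \<in> carrier (Zp p)" for x y
    by (rule extensionalityI[where A = P])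
       (use ext mult[OF that] in \<open>auto simp: compose_def\<close>)
  then have "act \<in> hom (Zp p) (BijGroup P)"
    by (auto simp: hom_def BijGroup_def bij)
  then show ?thesis
    by (simp add: group_action_def group_hom_def group_hom_axioms_def group_BijGroup)
qed

lemma add_mod_eq_iff_Zp:
  fixes g a b :: int
  assumes "0 \<le> a" "a < int p" "0 \<le> b" "b < int p"
  shows "(g + a) mod int p = (g + b) mod int p \<longleftrightarrow> a = b"
proof
  assume "(g + a) mod int p = (g + b) mod int p"
  then have "(g + a - g) mod int p = (g + b - g) mod int p"
    by (rule mod_diff_cong) (rule refl)
  then show "a = b" using assms by simp
qed simp

lemma Q_act_simp:
  "g \<in> carrier (Zp p) \<Longrightarrow> x \<in> Q_carrier n p \<Longrightarrow> Q_act n p g x = ((g + fst x) mod int p, snd x)"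
  by (simp add: Q_act_def)

lemma free_Zp_poset_Q:
  assumes p: "p > 0"
  shows "free_Zp_poset p (Q_carrier n p) Q_le (Q_act n p)"
proof -
  have act: "group_action (Zp p) (Q_carrier n p) (Q_act n p)"
  proof (rule group_action_ZpI[OF p])
    show "Q_act n p k \<in> extensional (Q_carrier n p)" for k
      by (simp add: Q_act_def)
    show cl: "Q_act n p k x \<in> Q_carrier n p"
      if "k \<in> carrier (Zp p)" "x \<in> Q_carrier n p" for k x
      using that p unfolding Q_act_simp[OF that]
      by (simp add: Q_carrier_def carrier_integer_mod_group mem_Times_iff)
    show "Q_act n p 0 x = x" if "x \<in> Q_carrier n p" for x
      using that p
      by (cases x) (simp add: Q_act_def Q_carrier_def carrier_integer_mod_group)
    fix k l x assume kl: "k \<in> carrier (Zp p)" "l \<in> carrier (Zp p)" and x: "x \<in> Q_carrier n p"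
    have "(k + l) mod int p \<in> carrier (Zp p)"
      using p by (simp add: carrier_integer_mod_group)
    then show "Q_act n p ((k + l) mod int p) x = Q_act n p k (Q_act n p l x)"
      using Q_act_simp[OF kl(1) cl[OF kl(2) x]]
      by (simp add: Q_act_simp kl x mod_add_left_eq mod_add_right_eq add.assoc)
  qed
  have inj: "(g + fst x) mod int p = (g + fst y) mod int p \<longleftrightarrow> fst x = fst y"
    if "x \<in> Q_carrier n p" "y \<in> Q_carrier n p" for g x y
    by (rule add_mod_eq_iff_Zp)
       (use that p in \<open>auto simp: Q_carrier_def carrier_integer_mod_group\<close>)
  have ord: "Q_le x y \<longleftrightarrow> Q_le (Q_act n p g x) (Q_act n p g y)"
    if "g \<in> carrier (Zp p)" "x \<in> Q_carrier n p" "y \<in> Q_carrier n p" for g x y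
    using that by (simp add: Q_act_simp Q_le_def inj prod_eq_iff)
  have free: "Q_act n p g x \<noteq> x"
    if "g \<in> carrier (Zp p)" "g \<noteq> 0" "x \<in> Q_carrier n p" for g x
  proof
    assume "Q_act n p g x = x"
    then have "(fst x + g) mod int p = fst x"
      using that by (simp add: Q_act_simp prod_eq_iff add.commute)
    moreover have "(fst x + 0) mod int p = fst x"
      using that p by (auto simp: Q_carrier_def carrier_integer_mod_group)
    moreover have "(fst x + g) mod int p = (fst x + 0) mod int p \<longleftrightarrow> g = 0"
      by (rule add_mod_eq_iff_Zp)
         (use that p in \<open>auto simp: carrier_integer_mod_group\<close>)
    ultimately show False using that by simp
  qed
  have "reflp_on (Q_carrier n p) Q_le" "antisymp_on (Q_carrier n p) Q_le"
    "transp_on (Q_carrier n p) Q_le"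
    by (auto simp: reflp_on_def antisymp_on_def transp_on_def Q_le_def)
  then show ?thesis
    using act ord free by (simp add: free_Zp_poset_def Zp_poset_def)
qed

lemma rotate_in_Hom_carrier:
  assumes "Us \<in> Hom_carrier p V E"
  shows "rotate k Us \<in> Hom_carrier p V E"
proof -
  have len: "length Us = p" using assms by (simp add: Hom_carrier_def)
  have nth: "rotate k Us ! i = Us ! ((k + i) mod p)" if "i < p" for i
    using that len by (simp add: nth_rotate add.commute)
  have all: "(\<forall>i<p. Q (rotate k Us ! i)) \<longleftrightarrow> (\<forall>i<p. Q (Us ! i))" for Q
  proof -
    have "(\<forall>i<p. Q (rotate k Us ! i)) \<longleftrightarrow> (\<forall>U\<in>set (rotate k Us). Q U)"
      by (simp only: all_set_conv_all_nth length_rotate len)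
    also have "\<dots> \<longleftrightarrow> (\<forall>i<p. Q (Us ! i))"
      by (simp only: all_set_conv_all_nth set_rotate len)
    finally show ?thesis .
  qed
  have inj: "(k + i) mod p \<noteq> (k + j) mod p" if "i < p" "j < p" "i \<noteq> j" for i j
  proof
    assume "(k + i) mod p = (k + j) mod p"
    then have "(int k + int i) mod int p = (int k + int j) mod int p"
      by (metis of_nat_add of_nat_mod)
    then show False using that by (simp add: add_mod_eq_iff_Zp)
  qed
  have "rotate k Us ! i \<inter> rotate k Us ! j = {}" if ij: "i < p" "j < p" "i \<noteq> j" for i j
  proof -
    have "(k + i) mod p < p" "(k + j) mod p < p" using ij by auto
    then show ?thesis
      using assms inj[OF ij] by (simp add: Hom_carrier_def nth ij)
  qed
  moreover have "\<forall>i<p. rotate k Us ! i \<subseteq> V \<and> rotate k Us ! i \<noteq> {}"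
    unfolding all[of "\<lambda>U. U \<subseteq> V \<and> U \<noteq> {}"] using assms by (simp add: Hom_carrier_def)
  moreover have "complete_partite p (rotate k Us) (parts_edges E (rotate k Us))"
    using assms
    by (simp add: Hom_carrier_def complete_partite_def parts_edges_def len
        all[of "\<lambda>U. card (_ \<inter> U) \<le> Suc 0"])
  ultimately show ?thesis
    by (simp add: Hom_carrier_def len)
qed

lemma free_Zp_poset_Hom:
  assumes p: "p > 0"
  shows "free_Zp_poset p (Hom_carrier p V E) Hom_le (Hom_act p V E)"
proof -
  have act: "group_action (Zp p) (Hom_carrier p V E) (Hom_act p V E)"
  proof (rule group_action_ZpI[OF p])
    show "Hom_act p V E k \<in> extensional (Hom_carrier p V E)" for k
      by (simp add: Hom_act_def)
    show "Hom_act p V E k Us \<in> Hom_carrier p V E" if "Us \<in> Hom_carrier p V E" for k Us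
      using that by (simp add: Hom_act_def rotate_in_Hom_carrier)
    show "Hom_act p V E 0 Us = Us" if "Us \<in> Hom_carrier p V E" for Us
      using that by (simp add: Hom_act_def)
    fix k l Us
    assume kl: "k \<in> carrier (Zp p)" "l \<in> carrier (Zp p)" and Us: "Us \<in> Hom_carrier p V E"
    have "nat ((k + l) mod int p) = (nat k + nat l) mod length Us"
      using kl Us p
      by (simp add: Hom_carrier_def carrier_integer_mod_group nat_mod_distrib nat_add_distrib)
    then show "Hom_act p V E ((k + l) mod int p) Us = Hom_act p V E k (Hom_act p V E l Us)"
      using Us by (simp add: Hom_act_def rotate_in_Hom_carrier rotate_rotate
          flip: rotate_conv_mod)
  qed
  have rot: "Hom_le (rotate m Us) (rotate m Ws)"
    if "Hom_le Us Ws" for m and Us Ws :: "'a set list"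
  proof -
    have "(m + i) mod length Ws < length Ws" if "i < length Ws" for i
      using that by (intro mod_less_divisor) auto
    then show ?thesis
      using that by (simp add: Hom_le_def list_all2_conv_all_nth nth_rotate)
  qed
  have ord: "Hom_le Us Ws \<longleftrightarrow> Hom_le (Hom_act p V E k Us) (Hom_act p V E k Ws)"
    if k: "k \<in> carrier (Zp p)" and U: "Us \<in> Hom_carrier p V E" and W: "Ws \<in> Hom_carrier p V E"
    for k Us Ws
  proof -
    have unrot: "rotate (p - nat k) (rotate (nat k) Xs) = Xs"
      if Xs: "Xs \<in> Hom_carrier p V E" for Xs
    proof -
      have "p - nat k + nat k = length Xs"
      proof -
        have "nat k < p" using k p by (simp add: carrier_integer_mod_group nat_less_iff)
        moreover have "length Xs = p" using Xs by (simp add: Hom_carrier_def)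
        ultimately show ?thesis by simp
      qed
      then show ?thesis by (simp only: rotate_rotate rotate_id mod_self)
    qed
    show ?thesis
      using rot[of Us Ws "nat k"] rot[of "rotate (nat k) Us" "rotate (nat k) Ws" "p - nat k"]
      unfolding unrot[OF U] unrot[OF W] by (auto simp: Hom_act_def U W)
  qed
  have free: "Hom_act p V E k Us \<noteq> Us"
    if k: "k \<in> carrier (Zp p)" "k \<noteq> 0" and Us: "Us \<in> Hom_carrier p V E" for k Us
  proof
    assume "Hom_act p V E k Us = Us"
    then have "rotate (nat k) Us ! 0 = Us ! 0" using Us by (simp add: Hom_act_def)
    moreover have "nat k < p" "0 < nat k" using k p by (auto simp: carrier_integer_mod_group)
    ultimately have "Us ! nat k = Us ! 0"
      using Us p by (simp add: Hom_carrier_def nth_rotate)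
    moreover have "Us ! nat k \<inter> Us ! 0 = {}" "Us ! 0 \<noteq> {}"
      using Us p \<open>nat k < p\<close> \<open>0 < nat k\<close> by (auto simp: Hom_carrier_def)
    ultimately show False by simp
  qed
  have "reflp_on (Hom_carrier p V E) Hom_le"
    by (simp add: reflp_on_def Hom_le_def list_all2_conv_all_nth)
  moreover have "antisymp_on (Hom_carrier p V E) Hom_le"
    unfolding antisymp_on_def Hom_le_def list_all2_conv_all_nth
    by (metis nth_equalityI subset_antisym)
  moreover have "transp_on (Hom_carrier p V E) Hom_le"
    unfolding transp_on_def Hom_le_def list_all2_conv_all_nth
    by (metis subset_trans)
  ultimately show ?thesis
    using act ord free by (simp add: free_Zp_poset_def Zp_poset_def)
qed

text \<open>The minima in the local chromatic number and in the cross-index of the Hom complex are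
  taken over nonempty sets, and the maxima over finite nonempty ones.\<close>

lemma exists_proper_coloring:
  assumes "uniform_hypergraph p V E" "p \<ge> 2"
  shows "\<exists>c. proper_coloring E c"
proof -
  have "finite V" using assms by (simp add: uniform_hypergraph_def hypergraph_def)
  then obtain c :: "'a \<Rightarrow> nat" where c: "inj_on c V"
    by (meson finite_imp_inj_to_nat_seg)
  have False if e: "e \<in> E" and k: "\<forall>v\<in>e. c v = k" for e k
  proof -
    have "inj_on c e" "card e \<ge> 2"
      using e assms c by (auto simp: uniform_hypergraph_def hypergraph_def intro: inj_on_subset)
    moreover have "c ` e \<subseteq> {k}" using k by auto
    then have "card (c ` e) \<le> card {k}" by (intro card_mono) auto
    ultimately show False by (simp add: card_image)
  qed
  then show ?thesis unfolding proper_coloring_def by blast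
qed

lemma finite_nonempty_local_colors:
  assumes "hypergraph V E" "E \<noteq> {}"
  shows "finite {card (c ` closed_neighborhood V E (e - {v})) | e v. e \<in> E \<and> v \<in> e}"
    and "{card (c ` closed_neighborhood V E (e - {v})) | e v. e \<in> E \<and> v \<in> e} \<noteq> {}"
proof -
  have V: "finite V" and E: "\<And>e. e \<in> E \<Longrightarrow> e \<subseteq> V \<and> e \<noteq> {}"
    using assms by (auto simp: hypergraph_def)
  have "{card (c ` closed_neighborhood V E (e - {v})) | e v. e \<in> E \<and> v \<in> e} \<subseteq>
    (\<lambda>(e, v). card (c ` closed_neighborhood V E (e - {v}))) ` (Pow V \<times> V)"
    using E by fastforce
  then show "finite {card (c ` closed_neighborhood V E (e - {v})) | e v. e \<in> E \<and> v \<in> e}"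
    by (rule finite_subset) (use V in simp)
  show "{card (c ` closed_neighborhood V E (e - {v})) | e v. e \<in> E \<and> v \<in> e} \<noteq> {}"
    using assms(2) E by blast
qed

lemma Hom_carrier_nonempty:
  assumes E: "uniform_hypergraph p V E" "E \<noteq> {}"
  shows "Hom_carrier p V E \<noteq> {}"
proof -
  obtain e where e: "e \<in> E" using E by blast
  then have eV: "e \<subseteq> V" "finite e" "card e = p"
    using E finite_subset[of e V] by (auto simp: uniform_hypergraph_def hypergraph_def)
  obtain xs where xs: "set xs = e" "distinct xs" using finite_distinct_list eV by blast
  then have len: "length xs = p" using eV distinct_card by fastforce
  let ?Us = "map (\<lambda>x. {x}) xs"
  have U: "\<Union>(set ?Us) = e" using xs by auto
  have "S = e" if "S \<subseteq> e" "card S = p" for S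
    using that eV by (metis card_subset_eq)
  moreover have "card (S \<inter> {x}) \<le> 1" for S :: "'a set" and x
    using card_mono[of "{x}" "S \<inter> {x}"] by simp
  ultimately have "complete_partite p ?Us (parts_edges E ?Us)"
    unfolding complete_partite_def parts_edges_def U using e by auto
  then have "?Us \<in> Hom_carrier p V E"
    using xs len eV by (auto simp: Hom_carrier_def nth_eq_iff_index_eq)
  then show ?thesis by blast
qed

lemma exists_Hom_Q_map:
  assumes V: "finite V" and p: "p > 0"
  shows "\<exists>n. \<exists>f \<in> Hom_carrier p V E \<rightarrow> Q_carrier n p. monotone_on (Hom_carrier p V E) Hom_le Q_le f \<and>
     (\<forall>g\<in>carrier (Zp p). \<forall>x\<in>Hom_carrier p V E. f (Hom_act p V E g x) = Q_act n p g (f x))"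
proof -
  obtain c :: "'a \<Rightarrow> nat" where c: "inj_on c V"
    using V by (meson finite_imp_inj_to_nat_seg)
  let ?H = "Hom_carrier p V E"
  let ?U = "\<lambda>Us :: 'a set list. \<Union>(set Us)"
  define m where "m Us = Min (c ` ?U Us)" for Us
  define P where "P Us i \<longleftrightarrow> i < p \<and> m Us \<in> c ` (Us ! i)" for Us i
  define idx where "idx Us = (THE i. P Us i)" for Us
  define f where "f Us = ((- int (idx Us)) mod int p, card (?U Us))" for Us
  have len: "length Us = p" and nth: "\<And>i. i < p \<Longrightarrow> Us ! i \<subseteq> V \<and> Us ! i \<noteq> {}"
    and disj: "\<And>i j. i < p \<Longrightarrow> j < p \<Longrightarrow> i \<noteq> j \<Longrightarrow> Us ! i \<inter> Us ! j = {}"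
    if "Us \<in> ?H" for Us
    using that by (simp_all add: Hom_carrier_def)
  have U_eq: "?U Us = (\<Union>i<p. Us ! i)" if "Us \<in> ?H" for Us
    using len[OF that] by (auto simp: set_conv_nth)
  have UV: "?U Us \<subseteq> V" if "Us \<in> ?H" for Us
    unfolding U_eq[OF that] using nth[OF that] by blast
  have Une: "?U Us \<noteq> {}" if "Us \<in> ?H" for Us
    unfolding U_eq[OF that] using nth[OF that p] p by blast
  have fin: "finite (?U Us)" if "Us \<in> ?H" for Us
    using UV[OF that] V finite_subset by blast
  have ex1: "\<exists>!i. P Us i" if Us: "Us \<in> ?H" for Us
  proof -
    have "m Us \<in> c ` ?U Us"
      unfolding m_def using Une[OF Us] fin[OF Us] by (intro Min_in) auto
    then obtain i where i: "i < p" "m Us \<in> c ` (Us ! i)"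
      unfolding U_eq[OF Us] by blast
    have "j = i" if j: "j < p" "m Us \<in> c ` (Us ! j)" for j
    proof (rule ccontr)
      assume ne: "j \<noteq> i"
      have "c ` (Us ! j \<inter> Us ! i) = c ` (Us ! j) \<inter> c ` (Us ! i)"
        by (rule inj_on_image_Int[OF c]) (use nth[OF Us] i j in auto)
      then show False unfolding disj[OF Us j(1) i(1) ne] using i(2) j(2) by blast
    qed
    then show ?thesis using i unfolding P_def by blast
  qed
  have idx: "P Us (idx Us)" if "Us \<in> ?H" for Us
    unfolding idx_def by (rule theI'[OF ex1[OF that]])
  have idx_eq: "idx Us = i" if "Us \<in> ?H" "P Us i" for Us i
    using ex1[OF that(1)] idx[OF that(1)] that(2) by blast
  have card_U: "1 \<le> card (?U Us)" "card (?U Us) \<le> card V" if "Us \<in> ?H" for Us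
    using Une[OF that] fin[OF that] card_mono[OF V UV[OF that]]
    by (simp_all add: Suc_le_eq card_gt_0_iff)
  have fH: "f \<in> ?H \<rightarrow> Q_carrier (card V) p"
  proof
    fix Us assume Us: "Us \<in> ?H"
    show "f Us \<in> Q_carrier (card V) p"
      using card_U[OF Us] p by (simp add: f_def Q_carrier_def carrier_integer_mod_group)
  qed
  have mono: "Q_le (f Us) (f Ws)" if H: "Us \<in> ?H" "Ws \<in> ?H" and le: "Hom_le Us Ws" for Us Ws
  proof (cases "Us = Ws")
    case False
    have sub: "Us ! i \<subseteq> Ws ! i" if "i < p" for i
      using le that H by (simp add: Hom_le_def list_all2_conv_all_nth len)
    obtain i where i: "i < p" "Us ! i \<noteq> Ws ! i"
      using False len[OF H(1)] len[OF H(2)] nth_equalityI[of Us Ws] by auto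
    then obtain x where x: "x \<in> Ws ! i" "x \<notin> Us ! i" using sub[of i] by blast
    have "x \<notin> Us ! j" if j: "j < p" for j
    proof (cases "j = i")
      case False
      then show ?thesis using x sub[OF j] disj[OF H(2) j i(1)] by blast
    qed (use x in simp)
    then have "?U Us \<noteq> ?U Ws"
      unfolding U_eq[OF H(1)] U_eq[OF H(2)] using x i(1) by blast
    moreover have "?U Us \<subseteq> ?U Ws"
      unfolding U_eq[OF H(1)] U_eq[OF H(2)] using sub by blast
    ultimately have "?U Us \<subset> ?U Ws" by blast
    then have "card (?U Us) < card (?U Ws)" using fin[OF H(2)] by (rule psubset_card_mono[rotated])
    then show ?thesis by (simp add: Q_le_def f_def)
  qed (simp add: Q_le_def)
  have equiv: "f (Hom_act p V E g Us) = Q_act (card V) p g (f Us)"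
    if g: "g \<in> carrier (Zp p)" and Us: "Us \<in> ?H" for g Us
  proof -
    define k where "k = nat g"
    have gk: "g = int k" using g p by (simp add: k_def carrier_integer_mod_group)
    define j where "j = nat ((int (idx Us) - g) mod int p)"
    have intj: "int j = (int (idx Us) - g) mod int p" using p by (simp add: j_def)
    have j: "j < p" using p by (simp add: j_def nat_less_iff)
    have "int ((k + j) mod p) = (int k + int j) mod int p" by (simp add: zmod_int)
    also have "\<dots> = int (idx Us) mod int p" by (simp add: intj gk mod_add_right_eq)
    finally have kj: "(k + j) mod p = idx Us"
      using idx[OF Us] by (simp add: P_def flip: zmod_int)
    have R: "rotate k Us \<in> ?H" using Us by (rule rotate_in_Hom_carrier)
    have "rotate k Us ! j = Us ! idx Us"
      using Us j kj by (simp add: Hom_carrier_def nth_rotate add.commute)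
    then have "P (rotate k Us) j" using idx[OF Us] j by (simp add: P_def m_def)
    then have "idx (rotate k Us) = j" using R idx_eq by blast
    moreover have "(- int j) mod int p = (g + (- int (idx Us)) mod int p) mod int p"
      unfolding intj by (simp add: mod_minus_eq mod_add_right_eq)
    ultimately have "f (rotate k Us) = Q_act (card V) p g (f Us)"
      using fH Us g by (simp add: Q_act_simp Pi_iff) (simp add: f_def)
    then show ?thesis using Us by (simp add: Hom_act_def k_def)
  qed
  show ?thesis using fH mono equiv by (auto intro!: exI[of _ "card V"] bexI[of _ f] monotone_onI)
qed

end

theory Submission
  imports Defs
begin

text \<open>
  Fix a proper coloring \<open>c\<close> and record, for a tuple \<open>(U\<^sub>1, \<dots>, U\<^sub>p)\<close> of the Hom complex, its color
  profile \<open>(c(U\<^sub>1), \<dots>, c(U\<^sub>p))\<close> and its weight \<open>\<Sum>\<^sub>i |c(U\<^sub>i)| \<ge> p\<close>. No color occurs in all the parts,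
  since it would give a monochromatic edge. So the profile, having nonempty entries, is not a
  constant tuple, and as \<open>p\<close> is prime, the cyclic group acts freely on the profiles. Hence they
  carry an equivariant sign in \<open>\<int>\<^sub>p\<close> (lemma \<open>equivariant_sign_exists\<close>). Sending a tuple to the sign
  of its profile, on the level given by its weight, is equivariant. It is also monotone: if \<open>U \<preceq> U'\<close>
  have equal weights, then they have equal profiles, so they have the same image. If every weight
  is at most \<open>n + p\<close>, then the image is contained in \<open>Q\<^bsub>n,p\<^esub>\<close>, so the cross-index is at most \<open>n\<close>.
  Consequently some tuple has weight at least the cross-index plus \<open>p\<close>
  (lemma \<open>exists_tuple_of_large_weight\<close>).

  In such a tuple, let \<open>U\<^sub>j\<close> be a part with the most colors, at least the average
  \<open>\<lceil>weight / p\<rceil>\<close>. If \<open>e\<close> is a transversal and \<open>v\<close> its vertex in \<open>U\<^sub>j\<close>, then completeness puts all of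
  \<open>U\<^sub>j\<close> into the closed neighborhood of \<open>e - {v}\<close>. If some part has a color that \<open>U\<^sub>j\<close>
  lacks, then a transversal through it sees one color more than \<open>U\<^sub>j\<close> has, which is the first term
  of the minimum. Otherwise all the colors of the tuple occur in \<open>U\<^sub>j\<close>, and since each occurs in at
  most \<open>p - 1\<close> parts, there are at least \<open>\<lceil>weight / (p - 1)\<rceil>\<close> of them, which is the second term.
\<close>

section \<open>Equivariant signs on nonconstant tuples of prime length\<close>

text \<open>This is where primality enters: a nonzero shift generates the whole cyclic group, so a tuple
  fixed by it is fixed by the shift by one.\<close>

lemma constant_of_rotate_eq:
  assumes p: "prime p" and len: "length A = p" and k: "0 < k" "k < p"
    and fixed: "rotate k A = A" and i: "i < p"
  shows "A ! i = A ! 0"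
proof -
  have p0: "p > 0" using p by (simp add: prime_gt_0_nat)
  have "coprime k p"
    using p k by (metis coprime_commute nat_dvd_not_less prime_imp_coprime)
  then obtain x y where xy: "k * x = p * y + 1"
    using bezout_nat[of k p] k by auto
  have step: "A ! ((k + m) mod p) = A ! m" if "m < p" for m
    using nth_rotate[of m A k] that fixed len by (simp add: add.commute)
  have mult: "A ! ((m * k) mod p) = A ! 0" for m
  proof (induction m)
    case (Suc m)
    have "A ! ((Suc m * k) mod p) = A ! ((k + (m * k) mod p) mod p)"
      by (simp add: mod_add_right_eq)
    also have "\<dots> = A ! ((m * k) mod p)"
      using p0 by (intro step) simp
    finally show ?case using Suc by simp
  qed simp
  have "(i * x) * k = i * (k * x)" by (simp only: ac_simps)
  also have "\<dots> = i + p * (y * i)" unfolding xy by (simp add: algebra_simps)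
  finally have "((i * x) * k) mod p = i" using i by simp
  then show ?thesis using mult[of "i * x"] by simp
qed

lemma rotate_inj_of_nonconstant:
  assumes p: "prime p" and len: "length A = p" and nc: "\<exists>i<p. A ! i \<noteq> A ! 0"
    and a: "a < p" and b: "b < p" and eq: "rotate a A = rotate b A"
  shows "a = b"
proof -
  have *: False if "a < b" "b < p" "rotate a A = rotate b A" for a b
  proof -
    have "p - a + a = p" using that by simp
    then have "rotate (p - a) (rotate a A) = A"
      using len by (simp only: rotate_rotate) simp
    moreover have "rotate (p - a) (rotate b A) = rotate (b - a) A"
    proof -
      have "p - a + b = (b - a) + p" using that by simp
      then have "rotate (p - a) (rotate b A) = rotate (b - a) (rotate p A)"
        by (simp only: rotate_rotate)
      then show ?thesis using len by simp
    qed
    ultimately have fixed: "rotate (b - a) A = A" by (simp only: that(3))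
    have "0 < b - a" "b - a < p" using that by simp_all
    then show False using constant_of_rotate_eq[OF p len _ _ fixed] nc by blast
  qed
  show ?thesis using *[of a b] *[of b a] a b eq by (metis linorder_neqE_nat)
qed

text \<open>A free action admits an equivariant map to the group: choose a representative in each orbit
  and measure the position of a tuple relative to the representative of its orbit.\<close>

lemma equivariant_sign_exists:
  assumes p: "prime p"
  shows "\<exists>s :: 'b list \<Rightarrow> nat. \<forall>A. length A = p \<and> (\<exists>i<p. A ! i \<noteq> A ! 0) \<longrightarrow>
    s A < p \<and> (\<forall>k. s (rotate k A) = (k + s A) mod p)"
proof -
  have p0: "p > 0" using p by (simp add: prime_gt_0_nat)
  define orb :: "'b list \<Rightarrow> 'b list set" where "orb A = range (\<lambda>k. rotate k A)" for A
  define rep where "rep A = (SOME B. B \<in> orb A)" for A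
  define s where "s A = (THE k. k < p \<and> rotate k (rep A) = A)" for A
  have unrot: "\<exists>m. rotate m (rotate k A) = A" if len: "length A = p" for k and A :: "'b list"
  proof -
    have "(p - k mod p + k) mod p = (p - k mod p + k mod p) mod p"
      by (simp add: mod_add_right_eq)
    also have "\<dots> = 0" using p0 by simp
    finally have "rotate (p - k mod p) (rotate k A) = A"
      using len by (simp add: rotate_rotate rotate_id)
    then show ?thesis by blast
  qed
  have orb_rot: "orb (rotate k A) = orb A" if len: "length A = p" for k A
  proof -
    obtain m where m: "rotate m (rotate k A) = A" using unrot[OF len] by blast
    have "rotate l A \<in> orb (rotate k A)" for l
      unfolding orb_def by (metis m rangeI rotate_rotate)
    then show ?thesis unfolding orb_def by (auto simp: rotate_rotate)
  qed
  have s_unique: "s A = k"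
    if A: "length A = p" "\<exists>i<p. A ! i \<noteq> A ! 0" and k: "k < p" "rotate k (rep A) = A" for A k
  proof -
    have len: "length (rep A) = p" using A k by (metis length_rotate)
    have nc: "\<exists>i<p. rep A ! i \<noteq> rep A ! 0"
    proof (rule ccontr)
      assume "\<not> ?thesis"
      then have "A ! i = rep A ! 0" if "i < p" for i
        using that len p0 k(2) nth_rotate[of i "rep A" k] by (metis mod_less_divisor)
      then show False using A(2) p0 by metis
    qed
    show ?thesis unfolding s_def
      using k rotate_inj_of_nonconstant[OF p len nc] by (intro the_equality) auto
  qed
  have s_ex: "s A < p \<and> rotate (s A) (rep A) = A"
    if A: "length A = p" "\<exists>i<p. A ! i \<noteq> A ! 0" for A
  proof -
    have "rep A \<in> orb A" unfolding rep_def by (rule someI[of _ A]) (auto simp: orb_def intro: range_eqI[of _ _ 0])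
    then obtain k where k: "rep A = rotate k A" by (auto simp: orb_def)
    obtain m where "rotate m (rep A) = A" using unrot[OF A(1), of k] k by auto
    moreover have "length (rep A) = p" using k A(1) by simp
    ultimately have m: "rotate (m mod p) (rep A) = A"
      using rotate_conv_mod[of m "rep A"] by simp
    then show ?thesis using s_unique[OF A _ m] p0 by simp
  qed
  have "s (rotate k A) = (k + s A) mod p"
    if A: "length A = p" "\<exists>i<p. A ! i \<noteq> A ! 0" for A k
  proof (rule s_unique)
    show "length (rotate k A) = p" using A by simp
    show "\<exists>i<p. rotate k A ! i \<noteq> rotate k A ! 0"
    proof (rule ccontr)
      assume "\<not> ?thesis"
      then have c: "rotate k A ! i = rotate k A ! 0" if "i < p" for i using that by blast
      obtain m where m: "rotate m (rotate k A) = A" using unrot[OF A(1)] by blast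
      have "A ! i = rotate k A ! 0" if "i < p" for i
        using that c[of "(m + i) mod p"] nth_rotate[of i "rotate k A" m] m A(1) p0
        by (simp add: add.commute)
      then show False using A(2) p0 by metis
    qed
    show "(k + s A) mod p < p" using p0 by simp
    have r: "rep (rotate k A) = rep A" by (simp add: rep_def orb_rot A)
    have "length (rep A) = p" using s_ex[OF A] A(1) by (metis length_rotate)
    then have "rotate ((k + s A) mod p) (rep A) = rotate (k + s A) (rep A)"
      using rotate_conv_mod[of "k + s A" "rep A"] by simp
    also have "\<dots> = rotate k (rotate (s A) (rep A))" by (simp only: rotate_rotate)
    also have "\<dots> = rotate k A" using s_ex[OF A] by simp
    finally show "rotate ((k + s A) mod p) (rep (rotate k A)) = rotate k A" by (simp only: r)
  qed
  then show ?thesis using s_ex by blast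
qed

section \<open>Color profiles in the Hom complex\<close>

definition weight :: "('a \<Rightarrow> nat) \<Rightarrow> 'a set list \<Rightarrow> nat" where
  "weight c Us = (\<Sum>U\<leftarrow>Us. card (c ` U))"

lemma weight_eq: "length Us = p \<Longrightarrow> weight c Us = (\<Sum>i<p. card (c ` (Us ! i)))"
  by (auto simp: weight_def sum_list_sum_nth atLeast0LessThan)

lemma weight_rotate: "weight c (rotate k Us) = weight c Us"
proof (induction k)
  case (Suc k)
  have "weight c (rotate1 Ws) = weight c Ws" for Ws
    by (cases Ws) (simp_all add: weight_def)
  then show ?case using Suc by simp
qed simp

lemma transversal_in_edges:
  assumes Us: "Us \<in> Hom_carrier p V E" and u: "\<And>i. i < p \<Longrightarrow> u i \<in> Us ! i"
  shows "u ` {..<p} \<in> E" and "inj_on u {..<p}"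
proof -
  have len: "length Us = p"
    and disj: "\<And>i j. i < p \<Longrightarrow> j < p \<Longrightarrow> i \<noteq> j \<Longrightarrow> Us ! i \<inter> Us ! j = {}"
    and compl: "complete_partite p Us (parts_edges E Us)"
    using Us by (simp_all add: Hom_carrier_def)
  show inj: "inj_on u {..<p}"
    by (rule inj_onI) (metis disj disjoint_iff lessThan_iff u)
  have "card (u ` {..<p} \<inter> Us ! i) \<le> 1" if i: "i < p" for i
  proof -
    have "u ` {..<p} \<inter> Us ! i \<subseteq> {u i}"
    proof
      fix x assume x: "x \<in> u ` {..<p} \<inter> Us ! i"
      then obtain l where "l < p" "x = u l" by blast
      then show "x \<in> {u i}" using x u[of l] disj[of l i] i by (cases "l = i") auto
    qed
    then show ?thesis using card_mono[of "{u i}"] by fastforce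
  qed
  moreover have "u ` {..<p} \<subseteq> \<Union>(set Us)"
    using u len nth_mem by fastforce
  moreover have "card (u ` {..<p}) = p" using inj by (simp add: card_image)
  ultimately have "u ` {..<p} \<in> parts_edges E Us"
    using compl len unfolding complete_partite_def by blast
  then show "u ` {..<p} \<in> E" by (simp add: parts_edges_def)
qed

text \<open>Vertices of the same color, one in each part, would form a monochromatic edge.\<close>

lemma color_misses_a_part:
  assumes Us: "Us \<in> Hom_carrier p V E" and c: "proper_coloring E c"
  shows "\<exists>i<p. k \<notin> c ` (Us ! i)"
proof (rule ccontr)
  assume "\<not> ?thesis"
  then have "\<forall>i. \<exists>x. i < p \<longrightarrow> x \<in> Us ! i \<and> c x = k" by fastforce
  then obtain u where u: "\<And>i. i < p \<Longrightarrow> u i \<in> Us ! i \<and> c (u i) = k" by metis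
  have "u ` {..<p} \<in> E" using transversal_in_edges(1)[OF Us] u by blast
  moreover have "\<forall>v\<in>u ` {..<p}. c v = k" using u by auto
  ultimately show False using c unfolding proper_coloring_def by blast
qed

lemma profile_nonconstant:
  assumes Us: "Us \<in> Hom_carrier p V E" and c: "proper_coloring E c" and p: "p > 0"
  shows "\<exists>i<p. map ((`) c) Us ! i \<noteq> map ((`) c) Us ! 0"
proof -
  have len: "length Us = p" and "Us ! 0 \<noteq> {}" using Us p by (simp_all add: Hom_carrier_def)
  then obtain x where x: "x \<in> Us ! 0" by blast
  obtain i where "i < p" "c x \<notin> c ` (Us ! i)" using color_misses_a_part[OF Us c] by blast
  then show ?thesis using x len p by (intro exI[of _ i]) auto
qed

lemma weight_ge_of_Hom:
  assumes Us: "Us \<in> Hom_carrier p V E" and V: "finite V"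
  shows "p \<le> weight c Us"
proof -
  have "1 \<le> card (c ` (Us ! i))" if "i < p" for i
  proof -
    have "Us ! i \<noteq> {}" "finite (Us ! i)"
      using that Us V finite_subset by (auto simp: Hom_carrier_def)
    then show ?thesis by (simp add: Suc_le_eq card_gt_0_iff)
  qed
  then have "(\<Sum>i<p. 1) \<le> (\<Sum>i<p. card (c ` (Us ! i)))" by (intro sum_mono) auto
  then show ?thesis using Us by (simp add: weight_eq Hom_carrier_def)
qed

text \<open>The sign depends on the profile alone, so it may change along \<open>\<preceq>\<close> only if some part gains a
  color. This raises the weight, and with it the level in the target poset.\<close>

lemma profile_eq_or_weight_less:
  assumes Us: "Us \<in> Hom_carrier p V E" and Ws: "Ws \<in> Hom_carrier p V E" and V: "finite V"
    and le: "Hom_le Us Ws"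
  shows "map ((`) c) Us = map ((`) c) Ws \<or> weight c Us < weight c Ws"
proof (rule disjCI)
  assume nl: "\<not> weight c Us < weight c Ws"
  have len: "length Us = p" "length Ws = p" using Us Ws by (simp_all add: Hom_carrier_def)
  have sub: "c ` (Us ! i) \<subseteq> c ` (Ws ! i)" if "i < p" for i
    using le len that by (intro image_mono) (simp add: Hom_le_def list_all2_conv_all_nth)
  have fin: "finite (c ` (Ws ! i))" if "i < p" for i
    using Ws V that finite_subset by (auto simp: Hom_carrier_def)
  have "c ` (Us ! i) = c ` (Ws ! i)" if i: "i < p" for i
  proof (rule ccontr)
    assume "c ` (Us ! i) \<noteq> c ` (Ws ! i)"
    then have "card (c ` (Us ! i)) < card (c ` (Ws ! i))"
      using sub[OF i] fin[OF i] by (intro psubset_card_mono) auto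
    then have "(\<Sum>i<p. card (c ` (Us ! i))) < (\<Sum>i<p. card (c ` (Ws ! i)))"
      using i card_mono[OF fin sub] by (intro sum_strict_mono_ex1) auto
    then show False using nl by (simp add: weight_eq len)
  qed
  then show "map ((`) c) Us = map ((`) c) Ws"
    using len by (auto intro!: nth_equalityI)
qed

text \<open>The sign of the profile and the weight form an equivariant monotone map. As weights range from
  \<open>p\<close> to \<open>n + p\<close>, and levels are counted from 1, a tuple is put on the level \<open>weight - p + 1\<close>.\<close>

lemma Xind_Hom_le_of_weight_le:
  assumes p: "prime p" and V: "finite V" and c: "proper_coloring E c"
    and bound: "\<And>Us. Us \<in> Hom_carrier p V E \<Longrightarrow> weight c Us \<le> n + p"
  shows "Xind_Hom p V E \<le> n"
proof -
  have p0: "p > 0" using p by (simp add: prime_gt_0_nat)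
  let ?H = "Hom_carrier p V E"
  obtain s :: "nat set list \<Rightarrow> nat" where
    s: "\<And>A. length A = p \<Longrightarrow> \<exists>i<p. A ! i \<noteq> A ! 0 \<Longrightarrow>
      s A < p \<and> (\<forall>k. s (rotate k A) = (k + s A) mod p)"
    using equivariant_sign_exists[OF p, where 'b = "nat set"] by blast
  define f where "f Us = (int (s (map ((`) c) Us)), weight c Us - p + 1)" for Us
  have sU: "s (map ((`) c) Us) < p \<and>
      (\<forall>k. s (rotate k (map ((`) c) Us)) = (k + s (map ((`) c) Us)) mod p)" if "Us \<in> ?H" for Us
    using that by (intro s profile_nonconstant[OF that c p0]) (simp add: Hom_carrier_def)
  have fH: "f Us \<in> Q_carrier n p" if "Us \<in> ?H" for Us
    using sU[OF that] bound[OF that] p0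
    by (auto simp: f_def Q_carrier_def carrier_integer_mod_group)
  have mono: "Q_le (f Us) (f Ws)" if H: "Us \<in> ?H" "Ws \<in> ?H" and le: "Hom_le Us Ws" for Us Ws
  proof -
    have wt: "weight c Us = weight c Ws" if "map ((`) c) Us = map ((`) c) Ws"
    proof -
      have "map card (map ((`) c) Us) = map card (map ((`) c) Ws)" using that by (rule arg_cong)
      then have "map (\<lambda>U. card (c ` U)) Us = map (\<lambda>U. card (c ` U)) Ws" by (simp add: comp_def)
      then show ?thesis by (simp only: weight_def)
    qed
    show ?thesis
      using profile_eq_or_weight_less[OF H V le, of c] weight_ge_of_Hom[OF H(1) V, of c] wt
      by (auto simp: f_def Q_le_def)
  qed
  have equiv: "f (Hom_act p V E g Us) = Q_act n p g (f Us)"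
    if g: "g \<in> carrier (Zp p)" and Us: "Us \<in> ?H" for g Us
  proof -
    have g0: "0 \<le> g" using g p0 by (simp add: carrier_integer_mod_group)
    have "s (map ((`) c) (rotate (nat g) Us)) = (nat g + s (map ((`) c) Us)) mod p"
      using sU[OF Us] by (simp add: rotate_map)
    then show ?thesis
      using Us g0 Q_act_simp[OF g fH[OF Us]] by (simp add: Hom_act_def f_def zmod_int weight_rotate)
  qed
  show ?thesis
    unfolding Xind_Hom_def Xind_def
    by (rule Least_le) (use fH mono equiv in \<open>auto intro!: bexI[of _ f] monotone_onI\<close>)
qed

lemma exists_tuple_of_large_weight:
  assumes p: "prime p" and E: "uniform_hypergraph p V E" "E \<noteq> {}" and c: "proper_coloring E c"
  shows "\<exists>Us \<in> Hom_carrier p V E. Xind_Hom p V E + p \<le> weight c Us"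
proof (rule ccontr)
  assume "\<not> ?thesis"
  then have small: "weight c Us < Xind_Hom p V E + p" if "Us \<in> Hom_carrier p V E" for Us
    using that by force
  have V: "finite V" using E by (simp add: uniform_hypergraph_def hypergraph_def)
  obtain Us where Us: "Us \<in> Hom_carrier p V E" using Hom_carrier_nonempty[OF E] by blast
  have pos: "0 < Xind_Hom p V E"
    using small[OF Us] weight_ge_of_Hom[OF Us V, of c] by simp
  have "Xind_Hom p V E \<le> Xind_Hom p V E - 1"
    by (rule Xind_Hom_le_of_weight_le[OF p V c]) (use small pos in fastforce)
  then show False using pos by simp
qed

section \<open>Colors seen from a transversal\<close>

text \<open>Replacing in a transversal its vertex of one part by any other vertex of that part gives another
  transversal, which is an edge by completeness.\<close>

lemma part_subset_neighborhood:
  assumes Us: "Us \<in> Hom_carrier p V E" and u: "\<And>i. i < p \<Longrightarrow> u i \<in> Us ! i" and j: "j < p"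
  shows "Us ! j \<subseteq> neighborhood V E (u ` {..<p} - {u j})"
proof
  fix w assume w: "w \<in> Us ! j"
  let ?X = "u ` {..<p} - {u j}"
  let ?u = "u(j := w)"
  have u': "?u i \<in> Us ! i" if "i < p" for i using u w that by simp
  have X: "u ` {..<p} - {u j} = u ` ({..<p} - {j})"
    using transversal_in_edges(2)[OF Us u] j by (subst inj_on_image_set_diff) auto
  have "?u ` {..<p} - ?X = {w}"
  proof -
    have "inj_on ?u {..<p}" using transversal_in_edges(2)[OF Us u'] by blast
    then have "w \<notin> ?u ` ({..<p} - {j})"
      using j inj_on_image_mem_iff[of ?u "{..<p}" j "{..<p} - {j}"] by auto
    moreover have eq: "?u ` ({..<p} - {j}) = u ` ({..<p} - {j})" by auto
    moreover have "?u ` {..<p} = insert w (u ` ({..<p} - {j}))" using j by auto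
    ultimately show ?thesis unfolding X by auto
  qed
  moreover have "?u ` {..<p} \<in> E" using transversal_in_edges(1)[OF Us u'] by blast
  moreover have "w \<in> V" using Us w j by (auto simp: Hom_carrier_def)
  ultimately show "w \<in> neighborhood V E ?X" unfolding neighborhood_def by blast
qed

text \<open>Double counting: every color lies in at most \<open>p - 1\<close> parts.\<close>

lemma weight_le_colors:
  assumes Us: "Us \<in> Hom_carrier p V E" and c: "proper_coloring E c"
    and fin: "finite K" and sub: "\<And>i. i < p \<Longrightarrow> c ` (Us ! i) \<subseteq> K"
  shows "weight c Us \<le> (p - 1) * card K"
proof -
  have "weight c Us = (\<Sum>i<p. card (c ` (Us ! i)))"
    using Us by (simp add: weight_eq Hom_carrier_def)
  also have "\<dots> = (\<Sum>i<p. \<Sum>k\<in>K. if k \<in> c ` (Us ! i) then 1 else 0)"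
  proof (rule sum.cong[OF refl])
    fix i assume "i \<in> {..<p}"
    then have "K \<inter> c ` (Us ! i) = c ` (Us ! i)" using sub by auto
    then show "card (c ` (Us ! i)) = (\<Sum>k\<in>K. if k \<in> c ` (Us ! i) then 1 else 0)"
      using fin by (simp add: sum.If_cases)
  qed
  also have "\<dots> = (\<Sum>k\<in>K. \<Sum>i<p. if k \<in> c ` (Us ! i) then 1 else 0)"
    by (rule sum.swap)
  also have "\<dots> \<le> (\<Sum>k\<in>K. p - 1)"
  proof (rule sum_mono)
    fix k
    obtain i where i: "i < p" "k \<notin> c ` (Us ! i)" using color_misses_a_part[OF Us c] by blast
    have "(\<Sum>i<p. if k \<in> c ` (Us ! i) then 1 else 0) =
        (\<Sum>i\<in>{..<p} - {i}. if k \<in> c ` (Us ! i) then 1 else (0::nat))"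
      using i by (intro sum.mono_neutral_right) auto
    also have "\<dots> \<le> (\<Sum>i\<in>{..<p} - {i}. 1)" by (intro sum_mono) simp
    also have "\<dots> = p - 1" using i by simp
    finally show "(\<Sum>i<p. if k \<in> c ` (Us ! i) then 1 else (0::nat)) \<le> p - 1" .
  qed
  finally show ?thesis by (simp add: mult.commute)
qed

text \<open>The two cases correspond to the two terms of the minimum: either some part has a color missing
  in a part with the most colors, or the latter has all the colors of the tuple.\<close>

lemma exists_edge_seeing_many_colors:
  assumes p: "prime p" and V: "finite V" and Us: "Us \<in> Hom_carrier p V E"
    and c: "proper_coloring E c"
  shows "\<exists>e\<in>E. \<exists>v\<in>e. let m = card (c ` closed_neighborhood V E (e - {v}))
    in weight c Us \<le> p * (m - 1) \<and> 1 \<le> m \<or> weight c Us \<le> (p - 1) * m"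
proof -
  have p0: "p > 0" using p by (simp add: prime_gt_0_nat)
  have ne: "\<And>i. i < p \<Longrightarrow> Us ! i \<noteq> {}" and UV: "\<And>i. i < p \<Longrightarrow> Us ! i \<subseteq> V"
    and len: "length Us = p"
    using Us by (auto simp: Hom_carrier_def)
  let ?a = "\<lambda>i. card (c ` (Us ! i))"
  have "Max (?a ` {..<p}) \<in> ?a ` {..<p}" using p0 by (intro Max_in) auto
  then obtain j where j1: "j < p" and j_max: "Max (?a ` {..<p}) = ?a j" by blast
  have "?a i \<le> ?a j" if "i < p" for i
    unfolding j_max[symmetric] using that by (intro Max_ge) auto
  note j = j1 this
  have wt: "weight c Us \<le> p * ?a j"
  proof -
    have "(\<Sum>i<p. ?a i) \<le> (\<Sum>i<p. ?a j)" by (intro sum_mono) (use j in auto)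
    then show ?thesis by (simp add: weight_eq len)
  qed
  obtain u where u: "\<And>i. i < p \<Longrightarrow> u i \<in> Us ! i"
  proof
    show "(SOME x. x \<in> Us ! i) \<in> Us ! i" if "i < p" for i
      using ne[OF that] by (simp add: some_in_eq)
  qed
  have seen: "u ` {..<p} \<in> E" "u j \<in> u ` {..<p}"
      "c ` (Us ! j) \<subseteq> c ` closed_neighborhood V E (u ` {..<p} - {u j})"
      "finite (c ` closed_neighborhood V E (u ` {..<p} - {u j}))"
    if u: "\<And>i. i < p \<Longrightarrow> u i \<in> Us ! i" for u
    using transversal_in_edges(1)[OF Us u] part_subset_neighborhood[OF Us u j(1)] j(1) V
    by (auto simp: closed_neighborhood_def neighborhood_def)
  show ?thesis
  proof (cases "\<exists>i<p. \<not> c ` (Us ! i) \<subseteq> c ` (Us ! j)")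
    case True
    then obtain i w where w: "i < p" "w \<in> Us ! i" "c w \<notin> c ` (Us ! j)" by blast
    let ?u = "u(i := w)"
    let ?K = "c ` closed_neighborhood V E (?u ` {..<p} - {?u j})"
    have u': "?u l \<in> Us ! l" if "l < p" for l using u w that by simp
    have "i \<noteq> j" using w by auto
    then have "?u i \<noteq> ?u j"
      using transversal_in_edges(2)[OF Us u'] j(1) w(1) unfolding inj_on_def by blast
    then have "w \<in> ?u ` {..<p} - {?u j}" using w(1) by force
    then have "c w \<in> ?K" unfolding closed_neighborhood_def by blast
    then have "insert (c w) (c ` (Us ! j)) \<subseteq> ?K" using seen(3)[OF u'] by blast
    then have "card (insert (c w) (c ` (Us ! j))) \<le> card ?K"
      using seen(4)[OF u'] by (intro card_mono)
    moreover have "finite (c ` (Us ! j))" using UV[OF j(1)] V finite_subset by blast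
    ultimately have m: "?a j + 1 \<le> card ?K" using w(3) by simp
    then have "p * ?a j \<le> p * (card ?K - 1)" by (intro mult_le_mono2) simp
    then show ?thesis
      unfolding Let_def using wt m
      by (intro bexI[OF _ seen(1)[OF u']] bexI[OF _ seen(2)[OF u']] disjI1 conjI) linarith+
  next
    case False
    let ?K = "c ` closed_neighborhood V E (u ` {..<p} - {u j})"
    have all: "c ` (Us ! i) \<subseteq> ?K" if "i < p" for i
      using False that seen(3)[OF u] by (meson subset_trans)
    have "weight c Us \<le> (p - 1) * card ?K"
      by (rule weight_le_colors[OF Us c seen(4)[OF u] all])
    then show ?thesis
      unfolding Let_def
      by (intro bexI[OF _ seen(1)[OF u]] bexI[OF _ seen(2)[OF u]] disjI2)
  qed
qed

theorem corollary4:
  fixes V :: "'a set" and E :: "'a set set" and p :: nat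
  assumes "prime p"
    and "uniform_hypergraph p V E"
    and "E \<noteq> {}"
  shows "int (local_chromatic_number V E) \<ge>
    min (\<lceil>(real (Xind_Hom p V E) + real p) / real p\<rceil> + 1)
        \<lceil>(real (Xind_Hom p V E) + real p) / (real p - 1)\<rceil>"
proof -
  have p2: "p \<ge> 2" using assms(1) by (rule prime_ge_2_nat)
  have H: "hypergraph V E" and V: "finite V"
    using assms(2) by (simp_all add: uniform_hypergraph_def hypergraph_def)
  let ?S = "\<lambda>c. {card (c ` closed_neighborhood V E (e - {v})) | e v. e \<in> E \<and> v \<in> e}"
  have "{c. proper_coloring E c} \<noteq> {}"
    using exists_proper_coloring[OF assms(2) p2] by blast
  then have "local_chromatic_number V E \<in> (\<lambda>c. Max (?S c)) ` {c. proper_coloring E c}"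
    unfolding local_chromatic_number_def by (intro Inf_nat_def1) simp
  then obtain c where c: "proper_coloring E c" and lcn: "local_chromatic_number V E = Max (?S c)"
    by blast
  obtain Us where Us: "Us \<in> Hom_carrier p V E" and large: "Xind_Hom p V E + p \<le> weight c Us"
    using exists_tuple_of_large_weight[OF assms c] by blast
  obtain e v where ev: "e \<in> E" "v \<in> e" and many:
    "let m = card (c ` closed_neighborhood V E (e - {v}))
     in weight c Us \<le> p * (m - 1) \<and> 1 \<le> m \<or> weight c Us \<le> (p - 1) * m"
    using exists_edge_seeing_many_colors[OF assms(1) V Us c] by blast
  define m where "m = card (c ` closed_neighborhood V E (e - {v}))"
  have "m \<le> Max (?S c)"
    using finite_nonempty_local_colors(1)[OF H assms(3)] ev unfolding m_def
    by (intro Max_ge) auto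
  then have mle: "int m \<le> int (local_chromatic_number V E)" by (simp add: lcn)
  let ?N = "real (Xind_Hom p V E) + real p"
  consider "Xind_Hom p V E + p \<le> p * (m - 1)" "1 \<le> m" | "Xind_Hom p V E + p \<le> (p - 1) * m"
    using many large unfolding Let_def m_def by fastforce
  then have "min (\<lceil>?N / real p\<rceil> + 1) \<lceil>?N / (real p - 1)\<rceil> \<le> int m"
  proof cases
    case 1
    have "real (Xind_Hom p V E + p) \<le> real (p * (m - 1))" using 1(1) by (simp only: of_nat_le_iff)
    then have "?N / real p \<le> real m - 1"
      using p2 1(2) by (simp add: pos_divide_le_eq of_nat_diff mult.commute)
    then have "\<lceil>?N / real p\<rceil> \<le> int m - 1" by (intro ceiling_le) simp
    then show ?thesis by simp
  next
    case 2
    have "real (Xind_Hom p V E + p) \<le> real ((p - 1) * m)" using 2 by (simp only: of_nat_le_iff)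
    then have "?N / (real p - 1) \<le> real m"
      using p2 by (simp add: pos_divide_le_eq of_nat_diff mult.commute)
    then have "\<lceil>?N / (real p - 1)\<rceil> \<le> int m" by (intro ceiling_le) simp
    then show ?thesis by simp
  qed
  then show ?thesis using mle by linarith
qed

end
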